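(* Let $R=k[x_1,\ldots,x_d]$ where $k$ is an algebraically closed field, and let $n$ be a positive integer. For every $\mathbf{g}_1,\ldots,\mathbf{g}_m,\mathbf{f}\in R^n$ the following are equivalent. (1) $\mathbf{f}$ belongs to the smallest semiprime submodule of $R^n$ that contains $\mathbf{g}_1,\ldots,\mathbf{g}_m$. (2) For every $a\in k^d$ and $\mathbf{v}\in k^n$ such that $\mathbf{g}_1(a)\mathbf{v}=\ldots=\mathbf{g}_m(a)\mathbf{v}=0$ we have $\mathbf{f}(a)\mathbf{v}=0$.
   Context: A submodule $N$ of $R^n$ is semiprime if for every $\mathbf{f}=(f_1,\ldots,f_n)\in R^n$ such that $f_i\mathbf{f}\in N$ for $i=1,\ldots,n$ we have $\mathbf{f}\in N$ (it is not required to be proper). "Smallest" is with respect to inclusion. For $\mathbf{g}=(g_1,\ldots,g_n)\in k[x_1,\ldots,x_d]^n$, $\mathbf{v}=(v_1,\ldots,v_n)\in k^n$ and $a\in k^d$ we write $\mathbf{g}(a)\mathbf{v}=\sum_{i=1}^n g_i(a)v_i$. *)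

theory Defs
  imports
    "HOL-Library.Poly_Mapping"
    "HOL-Library.FuncSet"
    "HOL-Computational_Algebra.Polynomial"
    "HOL-Analysis.Finite_Cartesian_Product"
begin

text \<open>
  A polynomial is a finitely supported map from exponent vectors to coefficients, with the
  convolution product of \<^theory>\<open>HOL-Library.Poly_Mapping\<close>. The type has countably many variables
  \<open>x\<^sub>0, x\<^sub>1, \<dots>\<close>; the ring \<open>k[x\<^sub>1, \<dots>, x\<^sub>d]\<close> is the subset \<open>polys d\<close>. The number
  of variables is a natural number rather than a finite index type because types are nonempty,
  which would rule out \<open>d = 0\<close>. In contrast, \<open>R\<^sup>n\<close> is only needed for \<open>n \<ge> 1\<close>, so its index set
  is a finite type.
\<close>

type_synonym 'k mpoly = "(nat \<Rightarrow>\<^sub>0 nat) \<Rightarrow>\<^sub>0 'k"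

definition polys :: "nat \<Rightarrow> 'k::comm_ring_1 mpoly set" where
  "polys d = {p. \<forall>m \<in> Poly_Mapping.keys p. Poly_Mapping.keys m \<subseteq> {1..d}}"

definition eval_poly :: "(nat \<Rightarrow> 'k) \<Rightarrow> 'k::comm_ring_1 mpoly \<Rightarrow> 'k" where
  "eval_poly a p =
     (\<Sum>m \<in> Poly_Mapping.keys p.
        Poly_Mapping.lookup p m *
        (\<Prod>i \<in> Poly_Mapping.keys m. a i ^ Poly_Mapping.lookup m i))"

definition affine_space :: "nat \<Rightarrow> (nat \<Rightarrow> 'k) set" where
  "affine_space d = ({1..d} \<rightarrow>\<^sub>E UNIV)"

definition poly_vecs :: "nat \<Rightarrow> ('k::comm_ring_1 mpoly ^ 'n::finite) set" where
  "poly_vecs d = {f. \<forall>i. f $ i \<in> polys d}"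

definition eval_pair :: "'k::comm_ring_1 mpoly ^ 'n::finite \<Rightarrow> (nat \<Rightarrow> 'k) \<Rightarrow> 'k ^ 'n \<Rightarrow> 'k" where
  "eval_pair g a v = (\<Sum>i \<in> UNIV. eval_poly a (g $ i) * v $ i)"

text \<open>
  The library's \<open>module.subspace\<close> takes all elements of the scalar type as scalars, whereas here
  only those in \<open>polys d\<close> are.
\<close>

definition submodule_of :: "nat \<Rightarrow> ('k::comm_ring_1 mpoly ^ 'n::finite) set \<Rightarrow> bool" where
  "submodule_of d N \<longleftrightarrow>
     N \<subseteq> poly_vecs d \<and> 0 \<in> N \<and>
     (\<forall>f \<in> N. \<forall>g \<in> N. f + g \<in> N) \<and>
     (\<forall>r \<in> polys d. \<forall>f \<in> N. r *s f \<in> N)"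

definition semiprime :: "nat \<Rightarrow> ('k::comm_ring_1 mpoly ^ 'n::finite) set \<Rightarrow> bool" where
  "semiprime d N \<longleftrightarrow>
     submodule_of d N \<and>
     (\<forall>f \<in> poly_vecs d. (\<forall>i. (f $ i) *s f \<in> N) \<longrightarrow> f \<in> N)"

text \<open>
  The order on sets is inclusion. That a least element exists is shown below.
\<close>

definition semiprime_closure ::
    "nat \<Rightarrow> ('k::comm_ring_1 mpoly ^ 'n::finite) set \<Rightarrow> ('k mpoly ^ 'n) set" where
  "semiprime_closure d G = (LEAST N. semiprime d N \<and> G \<subseteq> N)"

lemma polys_0: "0 \<in> polys d"
  by (simp add: polys_def)

lemma polys_add: "p \<in> polys d \<Longrightarrow> q \<in> polys d \<Longrightarrow> p + q \<in> polys d"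
  unfolding polys_def using Poly_Mapping.keys_add[of p q] by blast

lemma polys_mult:
  assumes "p \<in> polys d" "q \<in> polys d"
  shows "p * q \<in> polys d"
  unfolding polys_def
proof (intro CollectI ballI)
  fix m assume "m \<in> Poly_Mapping.keys (p * q)"
  then obtain a b where "m = a + b" "a \<in> Poly_Mapping.keys p" "b \<in> Poly_Mapping.keys q"
    using Poly_Mapping.keys_mult[of p q] by blast
  then show "Poly_Mapping.keys m \<subseteq> {1..d}"
    using assms Poly_Mapping.keys_add[of a b] unfolding polys_def by blast
qed

lemma semiprime_poly_vecs: "semiprime d (poly_vecs d)"
  by (simp add: semiprime_def submodule_of_def poly_vecs_def polys_0 polys_add polys_mult)

lemma semiprime_Inter:
  assumes "\<N> \<noteq> {}" "\<And>N. N \<in> \<N> \<Longrightarrow> semiprime d N"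
  shows "semiprime d (\<Inter>\<N>)"
proof -
  have "\<Inter>\<N> \<subseteq> poly_vecs d"
    using assms unfolding semiprime_def submodule_of_def by blast
  then show ?thesis
    using assms(2) unfolding semiprime_def submodule_of_def by simp
qed

lemma semiprime_closure_eq_Inter:
  assumes "G \<subseteq> poly_vecs d"
  shows "semiprime_closure d G = \<Inter>{N. semiprime d N \<and> G \<subseteq> N}"
  unfolding semiprime_closure_def
proof (rule Least_equality)
  have "semiprime d (\<Inter>{N. semiprime d N \<and> G \<subseteq> N})"
    using assms semiprime_poly_vecs by (intro semiprime_Inter) blast+
  then show "semiprime d (\<Inter>{N. semiprime d N \<and> G \<subseteq> N}) \<and>
      G \<subseteq> \<Inter>{N. semiprime d N \<and> G \<subseteq> N}"
    by blast
qed blast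

lemma semiprime_closure_least:
  assumes "G \<subseteq> poly_vecs d"
  shows "semiprime d (semiprime_closure d G)" and "G \<subseteq> semiprime_closure d G"
    and "\<And>N. semiprime d N \<Longrightarrow> G \<subseteq> N \<Longrightarrow> semiprime_closure d G \<subseteq> N"
proof -
  show "semiprime d (semiprime_closure d G)"
    unfolding semiprime_closure_eq_Inter[OF assms]
    using assms semiprime_poly_vecs by (intro semiprime_Inter) blast+
qed (unfold semiprime_closure_eq_Inter[OF assms], blast+)

end

theory Submission
  imports Defs
begin

text \<open>
  Vanishing on a set of pairs of a point \<open>a\<close> and a vector \<open>v\<close> defines a semiprime submodule
  (\<open>semiprime_vanishing\<close>), because a field has no nilpotent elements. This gives one implication.

  For the other one, let \<open>N\<close> be the semiprime closure of the \<open>g j\<close>, and suppose that \<open>f \<notin> N\<close>. The ideal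
  of all \<open>r\<close> with \<open>r *s f \<in> N\<close> is proper and radical; let \<open>P\<close> be a minimal prime over it. The
  observation that carries the proof (\<open>semiprime_ex_separating_functional\<close>) is that \<open>f\<close> remains outside
  \<open>N\<close> when one reduces modulo \<open>P\<close> and passes to the field of fractions. So a linear functional over
  that field separates \<open>f\<close> from \<open>N\<close>. Cleared of denominators, it is a vector \<open>w\<close> of polynomials such
  that the dot products of \<open>w\<close> with the elements of \<open>N\<close> are in \<open>P\<close>, but that with \<open>f\<close> is not. By
  Hilbert's Nullstellensatz for the prime ideal \<open>P\<close> (\<open>prime_ideal_ex_point\<close>) there is a zero \<open>a\<close> of \<open>P\<close>
  at which the dot product of \<open>f\<close> with \<open>w\<close> does not vanish. The point \<open>a\<close> and the vector \<open>w(a)\<close> violate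
  the vanishing condition.

  Hilbert's Nullstellensatz is proved by eliminating one variable at a time, working with prime ideals
  of \<open>A[X]\<close> and their contractions to \<open>A\<close> (\<open>ex_extension_point\<close>). Minimal primes and separating
  functionals are obtained from Zorn's lemma, so that Hilbert's basis theorem can be bypassed.
\<close>

section \<open>Subrings, prime ideals and homomorphisms\<close>

text \<open>
  Rings are sets inside a commutative ring type, because \<open>polys d\<close> is such a set, and the induction
  on the number of variables passes from one of them to the next.
\<close>

locale subring =
  fixes A :: "'a::comm_ring_1 set"
  assumes one: "1 \<in> A"
    and diff: "x \<in> A \<Longrightarrow> y \<in> A \<Longrightarrow> x - y \<in> A"
    and mult: "x \<in> A \<Longrightarrow> y \<in> A \<Longrightarrow> x * y \<in> A"
begin

lemma zero: "0 \<in> A"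
  using diff[OF one one] by simp

lemma add: "x \<in> A \<Longrightarrow> y \<in> A \<Longrightarrow> x + y \<in> A"
  using diff[of x "0 - y"] diff[OF zero, of y] by simp

lemma power: "x \<in> A \<Longrightarrow> x ^ n \<in> A"
  by (induction n) (auto simp: one mult)

lemma sum: "(\<And>i. i \<in> I \<Longrightarrow> f i \<in> A) \<Longrightarrow> sum f I \<in> A"
  by (induction I rule: infinite_finite_induct) (auto simp: zero add)

lemma prod: "(\<And>i. i \<in> I \<Longrightarrow> f i \<in> A) \<Longrightarrow> prod f I \<in> A"
  by (induction I rule: infinite_finite_induct) (auto simp: one mult)

end

locale prime_ideal = subring A for A :: "'a::comm_ring_1 set" +
  fixes P :: "'a set"
  assumes subset: "P \<subseteq> A"
    and zero_mem: "0 \<in> P"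
    and add_mem: "x \<in> P \<Longrightarrow> y \<in> P \<Longrightarrow> x + y \<in> P"
    and mult_mem: "a \<in> A \<Longrightarrow> x \<in> P \<Longrightarrow> a * x \<in> P"
    and one_notin: "1 \<notin> P"
    and prime: "x \<in> A \<Longrightarrow> y \<in> A \<Longrightarrow> x * y \<in> P \<Longrightarrow> x \<in> P \<or> y \<in> P"
begin

lemma mult_mem': "x \<in> P \<Longrightarrow> a \<in> A \<Longrightarrow> x * a \<in> P"
  using mult_mem[of a x] by (simp add: mult.commute)

lemma diff_mem: "x \<in> P \<Longrightarrow> y \<in> P \<Longrightarrow> x - y \<in> P"
  using add_mem[of x "(0 - 1) * y"] mult_mem[OF diff[OF zero one], of y] by simp

lemma sum_mem: "(\<And>i. i \<in> I \<Longrightarrow> f i \<in> P) \<Longrightarrow> sum f I \<in> P"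
  by (induction I rule: infinite_finite_induct) (auto simp: zero_mem add_mem)

lemma power_notin: "x \<in> A \<Longrightarrow> x \<notin> P \<Longrightarrow> x ^ n \<notin> P"
  by (induction n) (use one_notin prime power in auto)

lemma prod_notin:
  "finite I \<Longrightarrow> (\<And>i. i \<in> I \<Longrightarrow> f i \<in> A) \<Longrightarrow> (\<And>i. i \<in> I \<Longrightarrow> f i \<notin> P) \<Longrightarrow> prod f I \<notin> P"
proof (induction I rule: finite_induct)
  case (insert i I)
  then show ?case
    using prime[of "f i" "prod f I"] prod[of I f] by auto
qed (simp add: one_notin)

end

locale unital_hom =
  fixes \<phi> :: "'a::comm_ring_1 \<Rightarrow> 'b::comm_ring_1"
  assumes hom_add: "\<phi> (x + y) = \<phi> x + \<phi> y"
    and hom_mult: "\<phi> (x * y) = \<phi> x * \<phi> y"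
    and hom_one: "\<phi> 1 = 1"
begin

lemma hom_zero: "\<phi> 0 = 0"
  using hom_add[of 0 0] by simp

lemma hom_power: "\<phi> (x ^ n) = \<phi> x ^ n"
  by (induction n) (auto simp: hom_mult hom_one)

lemma map_poly_add: "map_poly \<phi> (p + q) = map_poly \<phi> p + map_poly \<phi> q"
  by (rule poly_eqI) (simp add: coeff_map_poly hom_zero hom_add)

lemma map_poly_mult: "map_poly \<phi> (p * q) = map_poly \<phi> p * map_poly \<phi> q"
proof (induction p)
  case (pCons a p)
  then show ?case
    by (simp add: map_poly_add map_poly_pCons map_poly_smult hom_zero hom_mult)
qed simp

lemma unital_hom_poly_map: "unital_hom (\<lambda>q. poly (map_poly \<phi> q) \<xi>)"
  by unfold_locales (simp_all add: map_poly_add map_poly_mult hom_one)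

end

text \<open>
  A root \<open>\<xi>\<close> of \<open>1 + X * q\<close> satisfies \<open>\<xi> * q(\<xi>) = -1\<close>. This is how the infinitude of an algebraically
  closed field enters.
\<close>

lemma alg_closed_ex_nonroot:
  fixes q :: "'k::alg_closed_field poly"
  assumes "q \<noteq> 0"
  shows "\<exists>\<xi>. poly q \<xi> \<noteq> 0"
proof -
  have "degree (pCons 1 q) > 0"
    using assms by simp
  then obtain \<xi> where "poly (pCons 1 q) \<xi> = 0"
    using alg_closed_imp_poly_has_root by blast
  then have "poly q \<xi> \<noteq> 0"
    by auto
  then show ?thesis ..
qed

section \<open>Prime ideals of univariate polynomial rings\<close>

definition polys_over :: "'a::comm_ring_1 set \<Rightarrow> 'a poly set" where
  "polys_over S = {q. \<forall>i. coeff q i \<in> S}"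

lemma (in subring) subring_polys_over: "subring (polys_over A)"
proof
  show "1 \<in> polys_over A"
    by (simp add: polys_over_def one zero coeff_1)
  show "x * y \<in> polys_over A" if "x \<in> polys_over A" "y \<in> polys_over A" for x y
    using that by (auto simp: polys_over_def coeff_mult intro!: sum mult)
qed (auto simp: polys_over_def diff)

lemma (in subring) monom_polys_over: "c \<in> A \<Longrightarrow> monom c n \<in> polys_over A"
  by (simp add: polys_over_def coeff_monom zero)

lemma (in subring) smult_polys_over: "c \<in> A \<Longrightarrow> q \<in> polys_over A \<Longrightarrow> smult c q \<in> polys_over A"
  by (simp add: polys_over_def mult)

lemma degree_minus_less:
  assumes "degree p \<le> n" "degree q \<le> n" "coeff p n = coeff q n" "0 < n"
  shows "degree (p - q :: 'a::comm_ring_1 poly) < n"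
proof -
  have "degree (p - q) \<le> n - 1"
  proof (rule degree_le, intro allI impI)
    fix i assume "n - 1 < i"
    then consider "i = n" | "n < i" by linarith
    then show "coeff (p - q) i = 0"
      by cases (use assms in \<open>auto simp: coeff_eq_0\<close>)
  qed
  then show ?thesis using assms(4) by simp
qed

text \<open>
  Division with remainder when the leading coefficient of the divisor cannot be inverted: the
  dividend is multiplied by a power of it instead.
\<close>

lemma (in subring) pseudo_division:
  assumes e: "e \<in> polys_over A" "0 < degree e" and h: "h \<in> polys_over A"
  shows "\<exists>N. \<exists>q\<in>polys_over A. \<exists>r\<in>polys_over A. smult (lead_coeff e ^ N) h = q * e + r \<and>
           degree r < degree e \<and> degree q \<le> degree h - degree e"
  using h
proof (induction "degree h" arbitrary: h rule: less_induct)
  case less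
  interpret AX: subring "polys_over A" by (rule subring_polys_over)
  let ?c = "lead_coeff e" and ?n = "degree e"
  have c: "?c \<in> A" and l: "lead_coeff h \<in> A"
    using e less.prems by (auto simp: polys_over_def)
  show ?case
  proof (cases "degree h < ?n")
    case True
    then show ?thesis
      using less.prems AX.zero by (intro exI[of _ 0] bexI[of _ 0] bexI[of _ h]) auto
  next
    case False
    define t where "t = monom (lead_coeff h) (degree h - ?n)"
    define h' where "h' = smult ?c h - t * e"
    have t: "t \<in> polys_over A"
      using l by (simp add: t_def monom_polys_over)
    have h'A: "h' \<in> polys_over A"
      using c t e less.prems by (auto simp: h'_def intro: AX.diff AX.mult smult_polys_over)
    have dt: "degree t \<le> degree h - ?n"
      by (simp add: t_def degree_monom_le)
    have "degree (t * e) \<le> degree h"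
      using degree_mult_le[of t e] dt False by simp
    moreover have "coeff (t * e) (degree h) = lead_coeff h * ?c"
      using False by (simp add: t_def coeff_monom_mult)
    ultimately have dh': "degree h' < degree h"
      unfolding h'_def using e False
      by (intro degree_minus_less) (auto simp: mult.commute intro: order_trans[OF degree_smult_le])
    obtain N q r where IH: "q \<in> polys_over A" "r \<in> polys_over A"
      "smult (?c ^ N) h' = q * e + r" "degree r < ?n" "degree q \<le> degree h' - ?n"
      using less.hyps[OF dh' h'A] by blast
    have "smult (?c ^ Suc N) h = smult (?c ^ N) (h' + t * e)"
      by (simp add: h'_def mult.commute)
    also have "\<dots> = (q + smult (?c ^ N) t) * e + r"
      by (simp add: smult_add_right IH(3) algebra_simps)
    finally have "smult (?c ^ Suc N) h = (q + smult (?c ^ N) t) * e + r" .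
    moreover have "degree (q + smult (?c ^ N) t) \<le> degree h - ?n"
      using IH(5) dh' dt degree_smult_le[of "?c ^ N" t] by (intro degree_add_le) auto
    moreover have "q + smult (?c ^ N) t \<in> polys_over A"
      using IH c t by (intro AX.add smult_polys_over power)
    ultimately show ?thesis
      using IH by blast
  qed
qed

text \<open>
  A prime ideal \<open>P\<close> of \<open>A[X]\<close> is compared with its contraction to \<open>A\<close>. Morally, \<open>P\<close> is either
  extended from the contraction, or it corresponds to an irreducible polynomial over the fraction
  field of \<open>A\<close> modulo the contraction. The fraction field is avoided by choosing polynomials of
  minimal degree and dividing with \<open>pseudo_division\<close>.
\<close>

locale poly_prime = subring A + PX: prime_ideal "polys_over A" P
  for A :: "'a::comm_ring_1 set" and P :: "'a poly set"
begin

definition contraction :: "'a set" where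
  "contraction = {c \<in> A. [:c:] \<in> P}"

lemma const_polys_over: "c \<in> A \<Longrightarrow> [:c:] \<in> polys_over A"
  using monom_polys_over[of c 0] by (simp add: monom_0)

lemma const_mult: "c \<in> A \<Longrightarrow> q \<in> P \<Longrightarrow> smult c q \<in> P"
  using PX.mult_mem[OF const_polys_over, of c q] by simp

sublocale C: prime_ideal A contraction
proof
  show "x \<in> contraction \<or> y \<in> contraction" if "x \<in> A" "y \<in> A" "x * y \<in> contraction" for x y
    using that PX.prime[of "[:x:]" "[:y:]"] const_polys_over
    by (auto simp: contraction_def mult.commute)
  show "x + y \<in> contraction" if "x \<in> contraction" "y \<in> contraction" for x y
    using that PX.add_mem[of "[:x:]" "[:y:]"] by (auto simp: contraction_def add)
  show "a * x \<in> contraction" if "a \<in> A" "x \<in> contraction" for a x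
    using that const_mult[of a "[:x:]"] by (auto simp: contraction_def mult)
qed (use PX.one_notin PX.zero_mem in \<open>auto simp: contraction_def zero one_pCons\<close>)

lemma polys_over_contraction: "q \<in> polys_over contraction \<Longrightarrow> q \<in> P"
proof (induction q)
  case 0
  show ?case by (rule PX.zero_mem)
next
  case (pCons a q)
  have "a \<in> contraction" "\<And>i. coeff q i \<in> contraction"
    using pCons.prems coeff_pCons_0[of a q] coeff_pCons_Suc[of a q]
    unfolding polys_over_def by (metis mem_Collect_eq)+
  then have "[:a:] \<in> P" "q \<in> P"
    using pCons.IH by (auto simp: polys_over_def contraction_def)
  moreover have "pCons a q = [:a:] + monom 1 1 * q"
    by (simp add: monom_altdef)
  ultimately show ?case
    using PX.add_mem PX.mult_mem[OF monom_polys_over[OF one]] by metis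
qed

text \<open>
  A leading term with coefficient in the contraction may be subtracted without leaving \<open>T\<close>, and
  this lowers the degree; so an element of minimal degree keeps its degree modulo the contraction.
\<close>

lemma ex_min_degree:
  assumes T: "T \<subseteq> polys_over A" "T \<noteq> {}" "0 \<notin> T"
    and shift: "\<And>t u. t \<in> T \<Longrightarrow> u \<in> polys_over contraction \<Longrightarrow> t - u \<in> T"
  shows "\<exists>t\<in>T. lead_coeff t \<notin> contraction \<and> (\<forall>t'\<in>T. degree t \<le> degree t')"
proof -
  obtain t where t: "t \<in> T" "\<And>t'. t' \<in> T \<Longrightarrow> degree t \<le> degree t'"
    using T(2) ex_has_least_nat[of "\<lambda>t. t \<in> T" _ degree] by (metis all_not_in_conv)
  have "lead_coeff t \<notin> contraction"
  proof
    assume l: "lead_coeff t \<in> contraction"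
    let ?u = "monom (lead_coeff t) (degree t)"
    have "?u \<in> polys_over contraction"
      using l C.zero_mem by (simp add: polys_over_def coeff_monom)
    then have tu: "t - ?u \<in> T"
      using shift t by blast
    show False
    proof (cases "degree t = 0")
      case True
      then have "t - ?u = 0"
        by (auto elim!: degree_eq_zeroE simp: monom_0)
      then show False using tu T(3) by simp
    next
      case False
      then have "degree (t - ?u) < degree t"
        by (intro degree_minus_less) (auto simp: degree_monom_le)
      then show False using t(2)[OF tu] by simp
    qed
  qed
  then show ?thesis using t by blast
qed

text \<open>
  The polynomial \<open>g\<close> plays the role of the irreducible generator of \<open>P\<close> over the fraction field: up to
  multiples of it, all elements of \<open>P\<close> have their coefficients in the contraction.
\<close>

lemma prime_contains_ex_min_degree:
  assumes "\<not> P \<subseteq> polys_over contraction"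
  obtains g where "g \<in> P" "lead_coeff g \<notin> contraction" "0 < degree g"
    and "\<And>q. q \<in> P \<Longrightarrow> degree q < degree g \<Longrightarrow> q \<in> polys_over contraction"
proof -
  let ?T = "P - polys_over contraction"
  have "t - u \<in> ?T" if t: "t \<in> ?T" and u: "u \<in> polys_over contraction" for t u
  proof -
    have "t \<in> polys_over contraction" if "\<And>i. coeff (t - u) i \<in> contraction"
      unfolding polys_over_def
    proof (intro CollectI allI)
      show "coeff t i \<in> contraction" for i
        using C.add_mem[OF that[of i], of "coeff u i"] u by (simp add: polys_over_def)
    qed
    then have "t - u \<notin> polys_over contraction"
      using t by (auto simp: polys_over_def)
    then show ?thesis using t PX.diff_mem[OF _ polys_over_contraction[OF u], of t] by simp
  qed
  moreover have "?T \<subseteq> polys_over A" "?T \<noteq> {}"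
    using assms PX.subset by auto
  moreover have "0 \<notin> ?T"
    using C.zero_mem by (simp add: polys_over_def)
  ultimately have "\<exists>g\<in>?T. lead_coeff g \<notin> contraction \<and> (\<forall>t'\<in>?T. degree g \<le> degree t')"
    by (intro ex_min_degree)
  then obtain g where g: "g \<in> ?T" "lead_coeff g \<notin> contraction"
      and g_min: "\<And>q. q \<in> ?T \<Longrightarrow> degree g \<le> degree q"
    by auto
  have "0 < degree g"
  proof (rule ccontr)
    assume "\<not> 0 < degree g"
    then have "g = [:lead_coeff g:]"
      by (auto elim!: degree_eq_zeroE)
    moreover have "lead_coeff g \<in> A"
      using g PX.subset by (auto simp: polys_over_def)
    ultimately show False using g by (auto simp: contraction_def)
  qed
  moreover have "q \<in> polys_over contraction" if "q \<in> P" "degree q < degree g" for q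
    using that g_min[of q] by fastforce
  ultimately show ?thesis using that[of g] g by simp
qed

text \<open>
  This is the statement that \<open>b\<close> is invertible modulo the maximal ideal generated by \<open>g\<close> over the
  fraction field, with denominators cleared. As in the usual proof that irreducible elements of a
  principal ideal domain generate maximal ideals, take an element \<open>e\<close> of minimal degree in the ideal
  generated by \<open>P\<close> and \<open>b\<close>, but outside \<open>P\<close>. If it were not constant, it would be a proper divisor
  of \<open>g\<close>, and the cofactor \<open>s\<close> would be in \<open>P\<close> and of smaller degree than \<open>g\<close>. Then the
  coefficients of \<open>s\<close> are in the contraction, so the leading coefficient of \<open>g\<close> is, too: absurd.
\<close>

lemma ex_const_in_extended_ideal:
  assumes g: "g \<in> P" "lead_coeff g \<notin> contraction" "0 < degree g"
    and g_min: "\<And>q. q \<in> P \<Longrightarrow> degree q < degree g \<Longrightarrow> q \<in> polys_over contraction"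
    and b: "b \<in> polys_over A" "b \<notin> P"
  shows "\<exists>c\<in>A - contraction. \<exists>u\<in>polys_over A. [:c:] - u * b \<in> P"
proof -
  let ?T = "{e \<in> polys_over A. e \<notin> P \<and> (\<exists>u\<in>polys_over A. e - u * b \<in> P)}"
  have gA: "g \<in> polys_over A" and lA: "lead_coeff g \<in> A"
    using g PX.subset by (auto simp: polys_over_def)
  have shift: "t - u \<in> ?T" if t: "t \<in> ?T" and u: "u \<in> P" for t u
  proof -
    obtain v where v: "v \<in> polys_over A" "t - v * b \<in> P"
      using t by blast
    have "t - u - v * b \<in> P"
      using PX.diff_mem[OF v(2) u] by (simp add: algebra_simps)
    moreover have "t - u \<notin> P"
      using t u PX.add_mem[of "t - u" u] by auto
    ultimately show ?thesis
      using v(1) t u PX.subset PX.diff[of t u] by auto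
  qed
  have scale: "p * t \<in> ?T" if t: "t \<in> ?T" and p: "p \<in> polys_over A" "p \<notin> P" for t p
  proof -
    obtain v where v: "v \<in> polys_over A" "t - v * b \<in> P"
      using t by blast
    have "p * t - (p * v) * b \<in> P"
      using PX.mult_mem[OF p(1) v(2)] by (simp add: algebra_simps)
    then show ?thesis
      using t p PX.mult[OF p(1) v(1)] PX.mult[OF p(1), of t] PX.prime[OF p(1), of t] by auto
  qed
  have "b \<in> ?T"
    using b PX.zero_mem PX.one by (auto intro!: bexI[of _ 1])
  then obtain e where e: "e \<in> ?T" "lead_coeff e \<notin> contraction"
      and e_min: "\<And>t. t \<in> ?T \<Longrightarrow> degree e \<le> degree t"
    using ex_min_degree[of ?T] shift polys_over_contraction PX.zero_mem
    by (smt (verit, best) empty_iff mem_Collect_eq subsetI)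
  have const_notin: "[:c ^ N:] \<notin> P" if "c \<in> A" "c \<notin> contraction" for c N
    using C.power_notin[OF that] power[OF that(1)] by (auto simp: contraction_def)
  have eA: "e \<in> polys_over A" "e \<notin> P" and leA: "lead_coeff e \<in> A"
    using e by (auto simp: polys_over_def)
  have "degree e = 0"
  proof (rule ccontr)
    assume "degree e \<noteq> 0"
    then have pos: "0 < degree e" by simp
    \<comment> \<open>\<open>e\<close> has smaller degree than \<open>g\<close>, as otherwise its remainder modulo \<open>g\<close> would be better.\<close>
    obtain N q r where 1: "q \<in> polys_over A" "r \<in> polys_over A"
      "smult (lead_coeff g ^ N) e = q * g + r" "degree r < degree g"
      using pseudo_division[OF gA g(3) eA(1)] by blast
    have "[:lead_coeff g ^ N:] * e - q * g \<in> ?T"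
      using shift scale[OF e(1) const_polys_over[OF power[OF lA]] const_notin[OF lA g(2)]]
        PX.mult_mem[OF 1(1) g(1)] by blast
    then have "r \<in> ?T" using 1(3) by simp
    then have deg: "degree e < degree g" using e_min[of r] 1(4) by simp
    \<comment> \<open>\<open>e\<close> divides \<open>g\<close> up to a factor and a remainder in \<open>P\<close>, by minimality of \<open>e\<close>.\<close>
    obtain M s t where 2: "s \<in> polys_over A" "t \<in> polys_over A"
      "smult (lead_coeff e ^ M) g = s * e + t" "degree t < degree e"
      "degree s \<le> degree g - degree e"
      using pseudo_division[OF eA(1) pos gA] by blast
    have tP: "t \<in> P"
    proof (rule ccontr)
      assume "t \<notin> P"
      have MP: "smult (lead_coeff e ^ M) g \<in> P"
        using const_mult[OF power[OF leA] g(1)] .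
      obtain v where v: "v \<in> polys_over A" "e - v * b \<in> P" using e by blast
      have "smult (lead_coeff e ^ M) g - s * (e - v * b) \<in> P"
        using PX.diff_mem[OF MP] PX.mult_mem[OF 2(1) v(2)] by blast
      then have "t - (0 - s * v) * b \<in> P"
        unfolding 2(3) by (simp add: algebra_simps)
      then have "t \<in> ?T"
        using 2(2) \<open>t \<notin> P\<close> PX.diff[OF PX.zero PX.mult[OF 2(1) v(1)]] by blast
      then show False using e_min 2(4) by fastforce
    qed
    have "s * e \<in> P"
      using PX.diff_mem[OF const_mult[OF power[OF leA] g(1)] tP, of M] 2(3) by simp
    then have "s \<in> P" using PX.prime 2(1) eA by blast
    moreover have "degree s < degree g" using 2(5) pos deg by simp
    ultimately have "s \<in> polys_over contraction" by (rule g_min)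
    then have "coeff (s * e) (degree g) \<in> contraction"
      using eA by (auto simp: coeff_mult polys_over_def intro!: C.sum_mem C.mult_mem')
    \<comment> \<open>The remainder \<open>t\<close> is too short to contribute to this coefficient.\<close>
    moreover have "coeff (s * e) (degree g) = lead_coeff e ^ M * lead_coeff g"
      using arg_cong[OF 2(3), of "\<lambda>p. coeff p (degree g)"] deg 2(4) by (simp add: coeff_eq_0)
    ultimately show False
      using C.prime[OF power[OF leA] lA] C.power_notin[OF leA e(2)] g(2) by simp
  qed
  then have "e = [:lead_coeff e:]"
    by (auto elim!: degree_eq_zeroE)
  then have "\<exists>u\<in>polys_over A. [:lead_coeff e:] - u * b \<in> P"
    using e(1) by simp
  then show ?thesis using e(2) leA by blast
qed

text \<open>
  The elimination step of the Nullstellensatz. A homomorphism to an algebraically closed field that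
  kills the contraction of \<open>P\<close> extends to one on \<open>A[X]\<close> that kills \<open>P\<close> but not \<open>b\<close>, as soon as it does
  not vanish on one particular element \<open>c\<close> outside the contraction. If \<open>P\<close> is extended from \<open>A\<close>, let
  \<open>c\<close> be a coefficient of \<open>b\<close>: it makes the image of \<open>b\<close> a nonzero polynomial, and every point at
  which this does not vanish will do. Otherwise \<open>X\<close> is sent to a root of the image of \<open>g\<close>; the factor
  \<open>lead_coeff g\<close> of \<open>c\<close> keeps that image nonconstant and makes the root one of the whole of \<open>P\<close>, and
  the other factor, from \<open>ex_const_in_extended_ideal\<close>, prevents \<open>b\<close> from vanishing there.
\<close>

lemma ex_extension_point:
  assumes b: "b \<in> polys_over A" "b \<notin> P"
  shows "\<exists>c\<in>A - contraction. \<forall>\<phi>::'a \<Rightarrow> 'k::alg_closed_field.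
           unital_hom \<phi> \<longrightarrow> (\<forall>x\<in>contraction. \<phi> x = 0) \<longrightarrow> \<phi> c \<noteq> 0 \<longrightarrow>
           (\<exists>\<xi>. (\<forall>q\<in>P. poly (map_poly \<phi> q) \<xi> = 0) \<and> poly (map_poly \<phi> b) \<xi> \<noteq> 0)"
proof (cases "P \<subseteq> polys_over contraction")
  case True
  then have "b \<notin> polys_over contraction"
    using b polys_over_contraction by blast
  then obtain i where i: "coeff b i \<in> A - contraction"
    using b by (auto simp: polys_over_def)
  show ?thesis
  proof (intro bexI[OF _ i] allI impI)
    fix \<phi> :: "'a \<Rightarrow> 'k"
    assume \<phi>: "unital_hom \<phi>" "\<forall>x\<in>contraction. \<phi> x = 0" "\<phi> (coeff b i) \<noteq> 0"
    interpret unital_hom \<phi> by fact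
    have "map_poly \<phi> b \<noteq> 0"
      using \<phi>(3) by (metis coeff_map_poly coeff_0 hom_zero)
    moreover have "map_poly \<phi> q = 0" if "q \<in> P" for q
      using that True \<phi>(2) by (intro poly_eqI) (auto simp: coeff_map_poly hom_zero polys_over_def)
    ultimately show "\<exists>\<xi>. (\<forall>q\<in>P. poly (map_poly \<phi> q) \<xi> = 0) \<and> poly (map_poly \<phi> b) \<xi> \<noteq> 0"
      using alg_closed_ex_nonroot[of "map_poly \<phi> b"] by auto
  qed
next
  case False
  then obtain g where g: "g \<in> P" "lead_coeff g \<notin> contraction" "0 < degree g"
    and g_min: "\<And>q. q \<in> P \<Longrightarrow> degree q < degree g \<Longrightarrow> q \<in> polys_over contraction"
    by (rule prime_contains_ex_min_degree) blast
  obtain c u where c: "c \<in> A - contraction" and u: "u \<in> polys_over A" "[:c:] - u * b \<in> P"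
    using ex_const_in_extended_ideal[OF g g_min b] by blast
  let ?l = "lead_coeff g"
  have gA: "g \<in> polys_over A" and l: "?l \<in> A"
    using g PX.subset by (auto simp: polys_over_def)
  have cl: "c * ?l \<in> A - contraction"
    using c l g(2) mult C.prime by blast
  show ?thesis
  proof (intro bexI[OF _ cl] allI impI)
    fix \<phi> :: "'a \<Rightarrow> 'k"
    assume \<phi>: "unital_hom \<phi>" "\<forall>x\<in>contraction. \<phi> x = 0" "\<phi> (c * ?l) \<noteq> 0"
    interpret unital_hom \<phi> by fact
    have nz: "\<phi> c \<noteq> 0" "\<phi> ?l \<noteq> 0"
      using \<phi>(3) by (auto simp: hom_mult)
    then have "coeff (map_poly \<phi> g) (degree g) \<noteq> 0"
      by (simp add: coeff_map_poly hom_zero)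
    then have "0 < degree (map_poly \<phi> g)"
      using g(3) le_degree by fastforce
    then obtain \<xi> where \<xi>: "poly (map_poly \<phi> g) \<xi> = 0"
      using alg_closed_imp_poly_has_root by blast
    interpret ev: unital_hom "\<lambda>q. poly (map_poly \<phi> q) \<xi>"
      by (rule unital_hom_poly_map)
    have root: "poly (map_poly \<phi> q) \<xi> = 0" if q: "q \<in> P" for q
    proof -
      obtain N s r where r: "s \<in> polys_over A" "r \<in> polys_over A"
        "smult (?l ^ N) q = s * g + r" "degree r < degree g"
        using pseudo_division[OF gA g(3)] q PX.subset by blast
      have "r = smult (?l ^ N) q - s * g" using r(3) by simp
      then have "r \<in> P"
        using PX.diff_mem[OF const_mult[OF power[OF l] q] PX.mult_mem[OF r(1) g(1)]] by simp
      then have "r \<in> polys_over contraction" using r(4) g_min by blast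
      then have "map_poly \<phi> r = 0"
        using \<phi>(2) by (intro poly_eqI) (auto simp: coeff_map_poly hom_zero polys_over_def)
      then have "poly (map_poly \<phi> (smult (?l ^ N) q)) \<xi> = 0"
        unfolding r(3) by (simp add: ev.hom_add ev.hom_mult \<xi>)
      then show ?thesis
        using nz by (simp add: map_poly_smult hom_zero hom_mult hom_power)
    qed
    have "poly (map_poly \<phi> b) \<xi> \<noteq> 0"
    proof
      assume 0: "poly (map_poly \<phi> b) \<xi> = 0"
      have "poly (map_poly \<phi> [:c:]) \<xi> = poly (map_poly \<phi> (([:c:] - u * b) + u * b)) \<xi>"
        by simp
      also have "\<dots> = 0"
        by (simp only: ev.hom_add ev.hom_mult 0 root[OF u(2)]) simp
      finally show False
        using nz by (simp add: map_poly_pCons hom_zero)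
    qed
    then show "\<exists>\<xi>. (\<forall>q\<in>P. poly (map_poly \<phi> q) \<xi> = 0) \<and> poly (map_poly \<phi> b) \<xi> \<noteq> 0"
      using root by blast
  qed
qed

end

section \<open>Evaluation of polynomials\<close>

abbreviation eval_monomial :: "(nat \<Rightarrow> 'k) \<Rightarrow> (nat \<Rightarrow>\<^sub>0 nat) \<Rightarrow> 'k::comm_ring_1" where
  "eval_monomial a m \<equiv> \<Prod>i \<in> Poly_Mapping.keys m. a i ^ Poly_Mapping.lookup m i"

lemma eval_monomial_add: "eval_monomial a (m + n) = eval_monomial a m * eval_monomial a n"
proof -
  define S where "S = Poly_Mapping.keys m \<union> Poly_Mapping.keys n"
  have *: "eval_monomial a l = (\<Prod>i\<in>S. a i ^ Poly_Mapping.lookup l i)"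
    if "Poly_Mapping.keys l \<subseteq> S" for l
    using that by (intro prod.mono_neutral_left) (auto simp: S_def in_keys_iff)
  have "Poly_Mapping.keys (m + n) \<subseteq> S"
    using Poly_Mapping.keys_add[of m n] by (simp add: S_def)
  then show ?thesis
    using *[of m] *[of n] *[of "m + n"]
    by (simp add: S_def lookup_add power_add prod.distrib)
qed

lemma eval_poly_single: "eval_poly a (Poly_Mapping.single m c) = c * eval_monomial a m"
  by (cases "c = 0") (simp_all add: eval_poly_def)

lemma eval_poly_add: "eval_poly a (p + q) = eval_poly a p + eval_poly a q"
proof -
  define S where "S = Poly_Mapping.keys p \<union> Poly_Mapping.keys q"
  have *: "eval_poly a r = (\<Sum>m\<in>S. Poly_Mapping.lookup r m * eval_monomial a m)"
    if "Poly_Mapping.keys r \<subseteq> S" for r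
    unfolding eval_poly_def
    using that by (intro sum.mono_neutral_left) (auto simp: S_def in_keys_iff)
  have "Poly_Mapping.keys (p + q) \<subseteq> S"
    using Poly_Mapping.keys_add[of p q] by (simp add: S_def)
  then show ?thesis
    using *[of p] *[of q] *[of "p + q"]
    by (simp add: S_def lookup_add distrib_right sum.distrib)
qed

lemma sum_single_lookup:
  "(\<Sum>m\<in>Poly_Mapping.keys p. Poly_Mapping.single m (Poly_Mapping.lookup p m)) = p"
  by (rule poly_mapping_eqI)
     (auto simp: lookup_sum lookup_single when_def in_keys_iff)

lemma eval_poly_sum: "eval_poly a (sum f I) = (\<Sum>i\<in>I. eval_poly a (f i))"
  by (induction I rule: infinite_finite_induct) (auto simp: eval_poly_add, auto simp: eval_poly_def)

lemma eval_poly_mult: "eval_poly a (p * q) = eval_poly a p * eval_poly a q"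
proof -
  let ?s = "\<lambda>p m. Poly_Mapping.single m (Poly_Mapping.lookup p m)"
  have "p * q = (\<Sum>m\<in>Poly_Mapping.keys p. ?s p m) * (\<Sum>n\<in>Poly_Mapping.keys q. ?s q n)"
    by (simp only: sum_single_lookup)
  then have "eval_poly a (p * q) =
      (\<Sum>m\<in>Poly_Mapping.keys p. \<Sum>n\<in>Poly_Mapping.keys q. eval_poly a (?s p m * ?s q n))"
    by (simp add: sum_product eval_poly_sum)
  also have "\<dots> = eval_poly a p * eval_poly a q"
    unfolding mult_single eval_poly_single eval_monomial_add
    by (simp add: eval_poly_def sum_product mult_ac)
  finally show ?thesis .
qed

lemma eval_poly_hom: "unital_hom (eval_poly a)"
  by unfold_locales
     (simp_all add: eval_poly_add eval_poly_mult eval_poly_single flip: single_one)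

lemma eval_poly_cong:
  assumes "p \<in> polys d" "\<And>i. i \<in> {1..d} \<Longrightarrow> a i = b i"
  shows "eval_poly a p = eval_poly b p"
  unfolding eval_poly_def
proof (intro sum.cong prod.cong arg_cong2[of _ _ _ _ "(*)"] arg_cong2[of _ _ _ _ "(^)"] refl)
  fix m i assume "m \<in> Poly_Mapping.keys p" "i \<in> Poly_Mapping.keys m"
  then show "a i = b i"
    using assms unfolding polys_def by blast
qed

lemma subring_polys: "subring (polys d :: 'k::comm_ring_1 mpoly set)"
proof
  have uminus: "- p \<in> polys d" if "p \<in> polys d" for p :: "'k mpoly"
    using that by (auto simp: polys_def in_keys_iff)
  show "p - q \<in> polys d" if "p \<in> polys d" "q \<in> polys d" for p q :: "'k mpoly"
    using polys_add[OF that(1) uminus[OF that(2)]] by simp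
  show "(1 :: 'k mpoly) \<in> polys d"
    by (simp add: polys_def)
qed (rule polys_mult)

section \<open>The Nullstellensatz for prime ideals\<close>

definition variable :: "nat \<Rightarrow> 'k::comm_ring_1 mpoly" where
  "variable i = Poly_Mapping.single (Poly_Mapping.single i 1) 1"

lemma variable_power:
  "variable i ^ e = Poly_Mapping.single (Poly_Mapping.single i e) 1"
  by (induction e) (simp_all add: variable_def mult_single flip: single_add)

lemma eval_poly_variable: "eval_poly a (variable i) = a i"
  by (simp add: variable_def eval_poly_single)

lemma poly_variable_in_polys:
  assumes "q \<in> polys_over (polys d)"
  shows "poly q (variable (Suc d)) \<in> polys (Suc d)"
proof -
  interpret subring "polys (Suc d)" by (rule subring_polys)
  have "variable (Suc d) \<in> polys (Suc d)"
    by (simp add: polys_def variable_def)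
  moreover have "coeff q i \<in> polys (Suc d)" for i
    using assms by (fastforce simp: polys_over_def polys_def)
  ultimately show ?thesis
    by (auto simp: poly_altdef intro: sum mult power)
qed

text \<open>
  Together with \<open>poly_variable_in_polys\<close>, this says that \<open>k[x\<^sub>1, \<dots>, x\<^sub>d\<^sub>+\<^sub>1]\<close> is the image of the
  univariate polynomials over \<open>k[x\<^sub>1, \<dots>, x\<^sub>d]\<close>. A surjection is enough, since prime ideals and
  evaluations can be pulled back along it.
\<close>

lemma ex_poly_variable:
  assumes "p \<in> polys (Suc d)"
  shows "\<exists>q\<in>polys_over (polys d). p = poly q (variable (Suc d))"
proof -
  interpret A: subring "polys d" by (rule subring_polys)
  interpret AX: subring "polys_over (polys d)" by (rule A.subring_polys_over)
  define q where "q m = monom (Poly_Mapping.single (Poly_Mapping.update (Suc d) 0 m)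
    (Poly_Mapping.lookup p m)) (Poly_Mapping.lookup m (Suc d))" for m
  have "q m \<in> polys_over (polys d)" if "m \<in> Poly_Mapping.keys p" for m
  proof -
    have "Poly_Mapping.keys m \<subseteq> {1..Suc d}"
      using assms that by (simp add: polys_def)
    then have "Poly_Mapping.keys (Poly_Mapping.update (Suc d) 0 m) \<subseteq> {1..d}"
      by (auto simp: keys_update le_Suc_eq)
    then show ?thesis
      unfolding q_def by (intro A.monom_polys_over) (auto simp: polys_def)
  qed
  moreover have "poly (q m) (variable (Suc d)) = Poly_Mapping.single m (Poly_Mapping.lookup p m)" for m
  proof -
    have "Poly_Mapping.update (Suc d) 0 m +
        Poly_Mapping.single (Suc d) (Poly_Mapping.lookup m (Suc d)) = m"
      by (rule poly_mapping_eqI)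
         (auto simp: lookup_add lookup_update lookup_single when_def)
    then show ?thesis
      by (simp add: q_def poly_monom variable_power mult_single)
  qed
  ultimately show ?thesis
    using sum_single_lookup[of p]
    by (intro bexI[of _ "\<Sum>m\<in>Poly_Mapping.keys p. q m"]) (auto simp: poly_sum intro: AX.sum)
qed

lemma eval_poly_poly_variable:
  assumes "q \<in> polys_over (polys d)"
  shows "eval_poly (a(Suc d := \<xi>)) (poly q (variable (Suc d))) = poly (map_poly (eval_poly a) q) \<xi>"
  using assms
proof (induction q)
  case 0
  show ?case by (simp add: eval_poly_def)
next
  case (pCons c q)
  interpret unital_hom "eval_poly a" by (rule eval_poly_hom)
  have coeff: "coeff (pCons c q) i \<in> polys d" for i
    using pCons.prems by (simp add: polys_over_def)
  have "eval_poly (a(Suc d := \<xi>)) c = eval_poly a c"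
    using coeff[of 0] by (intro eval_poly_cong[of _ d]) simp_all
  moreover have "q \<in> polys_over (polys d)"
    using coeff[of "Suc i" for i] by (simp add: polys_over_def)
  ultimately show ?case
    using pCons.IH
    by (simp add: eval_poly_add eval_poly_mult eval_poly_variable map_poly_pCons hom_zero
        del: fun_upd_apply)
      (simp add: eval_poly_variable)
qed

lemma prime_ideal_poly_variable:
  assumes "prime_ideal (polys (Suc d)) P"
  shows "prime_ideal (polys_over (polys d)) {q \<in> polys_over (polys d). poly q (variable (Suc d)) \<in> P}"
proof -
  interpret prime_ideal "polys (Suc d)" P by fact
  interpret A: subring "polys d" by (rule subring_polys)
  interpret AX: subring "polys_over (polys d)" by (rule A.subring_polys_over)
  show ?thesis
  proof
    show "x \<in> {q \<in> polys_over (polys d). poly q (variable (Suc d)) \<in> P} \<or>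
        y \<in> {q \<in> polys_over (polys d). poly q (variable (Suc d)) \<in> P}"
      if "x \<in> polys_over (polys d)" "y \<in> polys_over (polys d)"
        "x * y \<in> {q \<in> polys_over (polys d). poly q (variable (Suc d)) \<in> P}" for x y
      using that prime[OF poly_variable_in_polys poly_variable_in_polys, of x y] by simp
    show "x * y \<in> {q \<in> polys_over (polys d). poly q (variable (Suc d)) \<in> P}"
      if "x \<in> polys_over (polys d)" "y \<in> {q \<in> polys_over (polys d). poly q (variable (Suc d)) \<in> P}" for x y
      using that mult_mem[OF poly_variable_in_polys, of x] AX.mult[of x y] by simp
  qed (auto simp: AX.zero AX.add zero_mem add_mem one_notin)
qed

text \<open>
  Induction on the number of variables: \<open>ex_extension_point\<close> replaces \<open>b\<close> by a polynomial \<open>c\<close> in fewer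
  variables outside the contracted prime ideal, and then supplies the last coordinate of the point.
  The induction starts because constants outside a prime ideal are nonzero and those in it vanish.
\<close>

lemma prime_ideal_ex_point:
  fixes P :: "'k::alg_closed_field mpoly set"
  assumes "prime_ideal (polys d) P" "b \<in> polys d" "b \<notin> P"
  shows "\<exists>a\<in>affine_space d. (\<forall>p\<in>P. eval_poly a p = 0) \<and> eval_poly a b \<noteq> 0"
  using assms
proof (induction d arbitrary: P b)
  case 0
  interpret prime_ideal "polys 0" P by (rule 0)
  have const: "p = Poly_Mapping.single 0 (Poly_Mapping.lookup p 0)" if "p \<in> polys 0" for p :: "'k mpoly"
    using that by (intro poly_mapping_eqI)
      (auto simp: polys_def lookup_single when_def in_keys_iff)
  have P0: "p = 0" if "p \<in> P" for p
  proof (rule ccontr)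
    let ?c = "Poly_Mapping.lookup p 0"
    assume "p \<noteq> 0"
    have p: "p = Poly_Mapping.single 0 ?c"
      using that subset const by blast
    then have "?c \<noteq> 0"
      using \<open>p \<noteq> 0\<close> by (metis single_zero)
    then have "Poly_Mapping.single 0 (inverse ?c) * p = 1"
      by (subst p) (simp add: mult_single)
    moreover have "Poly_Mapping.single 0 (inverse ?c) \<in> polys 0"
      by (simp add: polys_def)
    ultimately show False
      using mult_mem[OF _ that] one_notin by metis
  qed
  let ?a = "\<lambda>_. undefined"
  have "eval_poly ?a b \<noteq> 0"
    using 0(3) zero_mem const[OF 0(2)]
    by (metis (no_types, lifting) eval_poly_single keys_zero mult.right_neutral prod.empty single_zero)
  moreover have "eval_poly ?a p = 0" if "p \<in> P" for p
    using P0[OF that] by (simp add: eval_poly_def)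
  ultimately show ?case
    by (intro bexI[of _ ?a]) (auto simp: affine_space_def)
next
  case (Suc d)
  let ?X = "variable (Suc d)"
  let ?Q = "{q \<in> polys_over (polys d). poly q ?X \<in> P}"
  interpret subring "polys d" by (rule subring_polys)
  interpret poly_prime "polys d" ?Q
    by (intro poly_prime.intro prime_ideal_poly_variable Suc.prems(1) subring_axioms)
  obtain q where q: "q \<in> polys_over (polys d)" "b = poly q ?X"
    using ex_poly_variable[OF Suc.prems(2)] by blast
  then have "q \<notin> ?Q"
    using Suc.prems(3) by simp
  from ex_extension_point[OF q(1) this, where ?'k = 'k]
  obtain c where c: "c \<in> polys d - contraction" and
    ext: "\<And>\<phi>::_ \<Rightarrow> 'k. unital_hom \<phi> \<Longrightarrow> \<forall>x\<in>contraction. \<phi> x = 0 \<Longrightarrow> \<phi> c \<noteq> 0 \<Longrightarrow>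
      \<exists>\<xi>. (\<forall>q\<in>?Q. poly (map_poly \<phi> q) \<xi> = 0) \<and> poly (map_poly \<phi> q) \<xi> \<noteq> 0"
    by blast
  obtain a where a: "a \<in> affine_space d" "\<forall>x\<in>contraction. eval_poly a x = 0" "eval_poly a c \<noteq> 0"
    using Suc.IH[OF C.prime_ideal_axioms, of c] c by blast
  obtain \<xi> where \<xi>: "\<And>q. q \<in> ?Q \<Longrightarrow> poly (map_poly (eval_poly a) q) \<xi> = 0"
    "poly (map_poly (eval_poly a) q) \<xi> \<noteq> 0"
    using ext[OF eval_poly_hom a(2,3)] by blast
  let ?a = "a(Suc d := \<xi>)"
  have "eval_poly ?a p = 0" if "p \<in> P" for p
  proof -
    have "p \<in> polys (Suc d)"
      using that Suc.prems(1) prime_ideal.subset by blast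
    then obtain r where r: "r \<in> polys_over (polys d)" "p = poly r ?X"
      using ex_poly_variable by blast
    then show ?thesis
      using \<xi>(1)[of r] that eval_poly_poly_variable[OF r(1), of a \<xi>] by simp
  qed
  moreover have "eval_poly ?a b \<noteq> 0"
    using \<xi>(2) q eval_poly_poly_variable[OF q(1), of a \<xi>] by simp
  moreover have "?a \<in> affine_space (Suc d)"
    using a(1) by (auto simp: affine_space_def PiE_def extensional_def)
  ultimately show ?case by blast
qed

section \<open>Minimal primes over a radical ideal\<close>

text \<open>
  The complement of a maximal multiplicative set \<open>S\<close> that avoids \<open>J\<close> is a minimal prime over \<open>J\<close>.
  In the localization at it, the radical ideal \<open>J\<close> becomes equal to \<open>P\<close>, the only prime left: this is
  the last conclusion. Directly, adjoining \<open>q \<notin> S\<close> to \<open>S\<close> must produce an element \<open>c * q ^ n\<close> of \<open>J\<close>,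
  and then \<open>c * q\<close> is in \<open>J\<close>, too.
\<close>

lemma (in subring) ex_minimal_prime:
  assumes J: "J \<subseteq> A" "1 \<notin> J"
    and J_add: "\<And>x y. x \<in> J \<Longrightarrow> y \<in> J \<Longrightarrow> x + y \<in> J"
    and J_mult: "\<And>a x. a \<in> A \<Longrightarrow> x \<in> J \<Longrightarrow> a * x \<in> J"
    and J_zero: "0 \<in> J"
    and radical: "\<And>x. x \<in> A \<Longrightarrow> x * x \<in> J \<Longrightarrow> x \<in> J"
  obtains P where "prime_ideal A P" "J \<subseteq> P"
    and "\<And>q. q \<in> P \<Longrightarrow> \<exists>c\<in>A - P. c * q \<in> J"
proof -
  have radical_power: "x \<in> J" if "x \<in> A" "x ^ n \<in> J" for x n
    using that(2)
  proof (induction n rule: less_induct)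
    case (less n)
    show ?case
    proof (cases "n \<le> 1")
      case True
      then show ?thesis using less.prems J(2) by (cases n) auto
    next
      case False
      \<comment> \<open>Halving the exponent, rounded up, shrinks it as long as it exceeds 1.\<close>
      define m where "m = (n + 1) div 2"
      have m: "m < n" "n \<le> m + m" using False by (auto simp: m_def)
      then have "x ^ m * x ^ m = x ^ (m + m - n) * x ^ n"
        by (simp only: power_add[symmetric] le_add_diff_inverse2)
      then have "x ^ m * x ^ m \<in> J"
        using J_mult[OF power[OF that(1)] less.prems] by simp
      then have "x ^ m \<in> J" using radical[OF power[OF that(1)]] by simp
      then show ?thesis using less.IH[OF m(1)] by simp
    qed
  qed
  define \<A> where "\<A> = {S. S \<subseteq> A \<and> 1 \<in> S \<and> (\<forall>x\<in>S. \<forall>y\<in>S. x * y \<in> S) \<and> S \<inter> J = {}}"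
  have "\<exists>S\<in>\<A>. \<forall>T\<in>\<A>. S \<subseteq> T \<longrightarrow> T = S"
  proof (rule subset_Zorn_nonempty)
    have "{1} \<in> \<A>" using one J(2) by (auto simp: \<A>_def)
    then show "\<A> \<noteq> {}" by blast
    fix \<C> assume \<C>: "\<C> \<noteq> {}" "subset.chain \<A> \<C>"
    have mem: "S \<subseteq> A" "1 \<in> S" "\<And>x y. x \<in> S \<Longrightarrow> y \<in> S \<Longrightarrow> x * y \<in> S" "S \<inter> J = {}"
      if "S \<in> \<C>" for S
      using \<C>(2) that by (auto simp: subset_chain_def \<A>_def)
    have "x * y \<in> \<Union>\<C>" if xy: "x \<in> \<Union>\<C>" "y \<in> \<Union>\<C>" for x y
    proof -
      obtain S T where ST: "x \<in> S" "S \<in> \<C>" "y \<in> T" "T \<in> \<C>" using xy by blast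
      then have "S \<subseteq> T \<or> T \<subseteq> S" using \<C>(2) by (auto simp: subset_chain_def)
      then have "x * y \<in> T \<or> x * y \<in> S"
        using mem(3)[OF ST(2), of x y] mem(3)[OF ST(4), of x y] ST by auto
      then show ?thesis using ST by auto
    qed
    moreover have "\<Union>\<C> \<subseteq> A" "\<Union>\<C> \<inter> J = {}"
      using mem(1,4) by auto
    moreover have "1 \<in> \<Union>\<C>"
      using \<C>(1) mem(2) by auto
    ultimately show "\<Union>\<C> \<in> \<A>" unfolding \<A>_def by simp
  qed
  then obtain S where S: "S \<in> \<A>" and S_max: "\<And>T. T \<in> \<A> \<Longrightarrow> S \<subseteq> T \<Longrightarrow> T = S"
    by blast
  have S_sub: "S \<subseteq> A" and S_one: "1 \<in> S" and S_disj: "S \<inter> J = {}"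
    and S_mult: "\<And>x y. x \<in> S \<Longrightarrow> y \<in> S \<Longrightarrow> x * y \<in> S"
    using S by (auto simp: \<A>_def)
  have kill: "\<exists>c\<in>S. c * q \<in> J" if q: "q \<in> A" "q \<notin> S" for q
  proof -
    let ?T = "{c * q ^ n | c n. c \<in> S}"
    have sup: "c \<in> ?T" if "c \<in> S" for c
    proof -
      have "c = c * q ^ 0" by simp
      then show ?thesis using that by blast
    qed
    have "q = 1 * q ^ 1" by simp
    then have "q \<in> ?T" using S_one by blast
    then have "?T \<noteq> S" using q by blast
    then have "?T \<notin> \<A>" using S_max[of ?T] sup by blast
    moreover have "?T \<subseteq> A" using S_sub power[OF q(1)] by (auto intro!: mult)
    moreover have "x * y \<in> ?T" if xy: "x \<in> ?T" "y \<in> ?T" for x y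
    proof -
      obtain c n c' n' where eq: "x = c * q ^ n" "y = c' * q ^ n'" and c: "c \<in> S" "c' \<in> S"
        using xy by blast
      have "x * y = (c * c') * q ^ (n + n')"
        by (simp add: eq power_add mult_ac)
      then show ?thesis using S_mult[OF c] by blast
    qed
    ultimately have "?T \<inter> J \<noteq> {}" using sup[OF S_one] unfolding \<A>_def by blast
    then obtain c n where c: "c \<in> S" "c * q ^ n \<in> J" by blast
    have "(c * q) ^ Suc n = (c ^ n * q) * (c * q ^ n)"
      by (simp add: power_mult_distrib mult_ac)
    then have "(c * q) ^ Suc n \<in> J"
      using J_mult[OF mult[OF power q(1)] c(2)] c(1) S_sub by auto
    then have "c * q \<in> J"
      using radical_power[of "c * q"] mult[of c q] c(1) S_sub q(1) by blast
    then show ?thesis using c(1) by blast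
  qed
  let ?P = "A - S"
  have P_iff: "q \<in> ?P" if "q \<in> A" "c \<in> S" "c * q \<in> J" for c q
    using that S_mult[of c q] S_disj by blast
  have "prime_ideal A ?P"
  proof
    show "x + y \<in> ?P" if xy: "x \<in> ?P" "y \<in> ?P" for x y
    proof -
      obtain c c' where c: "c \<in> S" "c * x \<in> J" "c' \<in> S" "c' * y \<in> J"
        using kill[of x] kill[of y] xy by auto
      have "c * c' * (x + y) = c' * (c * x) + c * (c' * y)"
        by (simp add: algebra_simps)
      then have "c * c' * (x + y) \<in> J"
        using c S_sub by (auto intro!: J_add J_mult)
      then show ?thesis using P_iff[OF _ S_mult[OF c(1,3)], of "x + y"] xy add[of x y] by simp
    qed
    show "a * x \<in> ?P" if ax: "a \<in> A" "x \<in> ?P" for a x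
    proof -
      obtain c where c: "c \<in> S" "c * x \<in> J"
        using kill[of x] ax by auto
      have "c * (a * x) = a * (c * x)" by (simp add: mult_ac)
      then have "c * (a * x) \<in> J" using J_mult[OF ax(1) c(2)] by (simp only:)
      then show ?thesis using P_iff[OF _ c(1), of "a * x"] ax mult[of a x] by simp
    qed
    show "0 \<in> ?P" using P_iff[OF zero S_one] J_zero by simp
    show "x \<in> ?P \<or> y \<in> ?P" if "x \<in> A" "y \<in> A" "x * y \<in> ?P" for x y
      using that S_mult[of x y] by auto
  qed (use S_one in auto)
  moreover have "J \<subseteq> ?P" using J(1) S_disj by blast
  moreover have "\<exists>c\<in>A - ?P. c * q \<in> J" if "q \<in> ?P" for q
    using that kill[of q] S_sub by blast
  ultimately show ?thesis by (rule that)
qed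

section \<open>Separating a vector from a submodule by a linear functional\<close>

abbreviation dot :: "'a::comm_ring_1 ^ 'n::finite \<Rightarrow> 'a ^ 'n \<Rightarrow> 'a" where
  "dot u w \<equiv> \<Sum>i\<in>UNIV. u $ i * w $ i"

lemma vec_eq_sum_axis: "(u :: 'a::comm_ring_1 ^ 'n::finite) = (\<Sum>i\<in>UNIV. u $ i *s axis i 1)"
  by (simp add: vec_eq_iff axis_def sum_component if_distrib cong: if_cong)

lemma submodule_of_diff:
  assumes "submodule_of d N" "x \<in> N" "y \<in> N"
  shows "x - y \<in> N"
proof -
  interpret subring "polys d" by (rule subring_polys)
  have "x + (0 - 1) *s y \<in> N"
    using assms diff[OF zero one] unfolding submodule_of_def by blast
  moreover have "x + (0 - 1) *s y = x - y"
    by (simp add: vec_eq_iff)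
  ultimately show ?thesis by simp
qed

lemma submodule_of_sum:
  assumes "submodule_of d N" "\<And>i. i \<in> I \<Longrightarrow> f i \<in> N"
  shows "sum f I \<in> N"
  using assms(2)
  by (induction I rule: infinite_finite_induct) (use assms(1) in \<open>auto simp: submodule_of_def\<close>)

lemma ex_max_submodule_avoiding:
  assumes "submodule_of d N" "N \<inter> F = {}"
  obtains M where "submodule_of d M" "N \<subseteq> M" "M \<inter> F = {}"
    and "\<And>L. submodule_of d L \<Longrightarrow> M \<subseteq> L \<Longrightarrow> L \<inter> F = {} \<Longrightarrow> L = M"
proof -
  define \<A> where "\<A> = {M. submodule_of d M \<and> N \<subseteq> M \<and> M \<inter> F = {}}"
  have "\<exists>M\<in>\<A>. \<forall>L\<in>\<A>. M \<subseteq> L \<longrightarrow> L = M"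
  proof (rule subset_Zorn_nonempty)
    show "\<A> \<noteq> {}" using assms by (auto simp: \<A>_def)
    fix \<C> assume \<C>: "\<C> \<noteq> {}" "subset.chain \<A> \<C>"
    have mem: "submodule_of d M" "N \<subseteq> M" "M \<inter> F = {}" if "M \<in> \<C>" for M
      using \<C>(2) that by (auto simp: subset_chain_def \<A>_def)
    have "x + y \<in> \<Union>\<C>" if xy: "x \<in> \<Union>\<C>" "y \<in> \<Union>\<C>" for x y
    proof -
      obtain S T where ST: "x \<in> S" "S \<in> \<C>" "y \<in> T" "T \<in> \<C>" using xy by blast
      then have "S \<subseteq> T \<or> T \<subseteq> S" using \<C>(2) by (auto simp: subset_chain_def)
      then have "x + y \<in> T \<or> x + y \<in> S"
        using mem(1)[OF ST(2)] mem(1)[OF ST(4)] ST by (auto simp: submodule_of_def)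
      then show ?thesis using ST by auto
    qed
    moreover have "r *s x \<in> \<Union>\<C>" if "r \<in> polys d" "x \<in> \<Union>\<C>" for r x
      using that mem(1) by (fastforce simp: submodule_of_def)
    moreover have "\<Union>\<C> \<subseteq> poly_vecs d"
      using mem(1) by (intro Union_least) (simp add: submodule_of_def)
    moreover obtain M where M: "M \<in> \<C>" using \<C>(1) by blast
    moreover from M have "0 \<in> \<Union>\<C>"
      using mem(1)[OF M] by (auto simp: submodule_of_def)
    ultimately have "submodule_of d (\<Union>\<C>)"
      unfolding submodule_of_def by simp
    then show "\<Union>\<C> \<in> \<A>" using M mem(2,3) unfolding \<A>_def by blast
  qed
  then obtain M where "M \<in> \<A>" and M_max: "\<And>L. L \<in> \<A> \<Longrightarrow> M \<subseteq> L \<Longrightarrow> L = M"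
    by blast
  then have M: "submodule_of d M" "N \<subseteq> M" "M \<inter> F = {}"
    by (auto simp: \<A>_def)
  moreover have "L = M" if "submodule_of d L" "M \<subseteq> L" "L \<inter> F = {}" for L
    using that M(2) by (intro M_max) (auto simp: \<A>_def)
  ultimately show ?thesis by (rule that)
qed

lemma submodule_of_adjoin:
  assumes M: "submodule_of d M" and u: "u \<in> poly_vecs d"
  shows "submodule_of d {x + r *s u | x r. x \<in> M \<and> r \<in> polys d}"
  unfolding submodule_of_def
proof (intro conjI ballI)
  interpret subring "polys d" by (rule subring_polys)
  let ?L = "{x + r *s u | x r. x \<in> M \<and> r \<in> polys d}"
  have M': "M \<subseteq> poly_vecs d" "0 \<in> M" "\<And>x y. x \<in> M \<Longrightarrow> y \<in> M \<Longrightarrow> x + y \<in> M"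
    "\<And>r x. r \<in> polys d \<Longrightarrow> x \<in> M \<Longrightarrow> r *s x \<in> M"
    using M unfolding submodule_of_def by auto
  show "?L \<subseteq> poly_vecs d"
    using M'(1) u by (auto simp: poly_vecs_def intro!: add mult dest!: subsetD)
  show "0 \<in> ?L"
    using M'(2) zero by (intro CollectI exI[of _ 0] conjI) auto
  show "x + y \<in> ?L" if xy: "x \<in> ?L" "y \<in> ?L" for x y
  proof -
    obtain v r v' r' where "x = v + r *s u" "y = v' + r' *s u"
      and *: "v \<in> M" "v' \<in> M" "r \<in> polys d" "r' \<in> polys d"
      using xy by blast
    then have "x + y = (v + v') + (r + r') *s u"
      by (simp add: vector_sadd_rdistrib algebra_simps)
    then show ?thesis using * M'(3) add by blast
  qed
  show "s *s x \<in> ?L" if s: "s \<in> polys d" and x: "x \<in> ?L" for s x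
  proof -
    obtain v r where "x = v + r *s u" and *: "v \<in> M" "r \<in> polys d"
      using x by blast
    then have "s *s x = s *s v + (s * r) *s u"
      by (simp add: vector_add_ldistrib vector_smult_assoc)
    then show ?thesis using * M'(4) mult s by blast
  qed
qed

text \<open>
  Over the fraction field \<open>K\<close> of \<open>polys d\<close> modulo \<open>P\<close>, the hypotheses say that \<open>f\<close> is not in the
  subspace spanned by \<open>N\<close>. A subspace \<open>M\<close> that is maximal among those without \<open>f\<close> is a hyperplane, and
  every unit vector is congruent modulo \<open>M\<close> to a multiple of \<open>f\<close>; the multipliers are the coordinates
  of a functional with kernel \<open>M\<close>. The proof carries this out with denominators cleared: \<open>M\<close> avoids
  all multiples of \<open>f\<close> by scalars outside \<open>P\<close>, and \<open>R\<close> is the common denominator of the coordinates.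
\<close>

lemma ex_separating_functional:
  fixes f :: "'k::comm_ring_1 mpoly ^ 'n::finite"
  assumes P: "prime_ideal (polys d) P" and N: "submodule_of d N"
    and PN: "\<And>u. (\<And>i. u $ i \<in> P) \<Longrightarrow> u \<in> N"
    and f: "f \<in> poly_vecs d" "\<And>s. s \<in> polys d - P \<Longrightarrow> s *s f \<notin> N"
  shows "\<exists>w\<in>poly_vecs d. (\<forall>u\<in>N. dot u w \<in> P) \<and> dot f w \<notin> P"
proof -
  interpret prime_ideal "polys d" P by (rule P)
  let ?F = "{s *s f | s. s \<in> polys d - P}"
  obtain M where M: "submodule_of d M" "N \<subseteq> M" "M \<inter> ?F = {}"
    and M_max: "\<And>L. submodule_of d L \<Longrightarrow> M \<subseteq> L \<Longrightarrow> L \<inter> ?F = {} \<Longrightarrow> L = M"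
    using ex_max_submodule_avoiding[OF N, of ?F] f(2) by blast
  have M': "M \<subseteq> poly_vecs d" "0 \<in> M" "\<And>x y. x \<in> M \<Longrightarrow> y \<in> M \<Longrightarrow> x + y \<in> M"
    "\<And>r x. r \<in> polys d \<Longrightarrow> x \<in> M \<Longrightarrow> r *s x \<in> M"
    using M(1) unfolding submodule_of_def by auto
  have PM: "p *s u \<in> M" if "p \<in> P" "u \<in> poly_vecs d" for p u
    using that M(2) by (intro subsetD[OF M(2)] PN) (auto simp: poly_vecs_def mult_mem')
  have in_P: "s \<in> P" if "s \<in> polys d" "s *s f \<in> M" for s
    using that M(3) by blast
  have ex: "\<exists>r\<in>polys d - P. \<exists>s\<in>polys d. r *s u - s *s f \<in> M" if u: "u \<in> poly_vecs d" for u
  proof (cases "u \<in> M")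
    case True
    then show ?thesis using one one_notin zero
      by (intro bexI[of _ 1] bexI[of _ 0]) auto
  next
    case False
    let ?L = "{x + r *s u | x r. x \<in> M \<and> r \<in> polys d}"
    have M_sub: "M \<subseteq> ?L"
    proof
      fix x assume "x \<in> M"
      moreover have "x = x + 0 *s u" by simp
      ultimately show "x \<in> ?L" using zero by blast
    qed
    have "u = 0 + 1 *s u" by simp
    then have "u \<in> ?L" using M'(2) one by blast
    then have "?L \<noteq> M" using False by blast
    then have "?L \<inter> ?F \<noteq> {}"
      using M_max[OF submodule_of_adjoin[OF M(1) u] M_sub] by blast
    then obtain z where z: "z \<in> ?L" "z \<in> ?F" by blast
    obtain s where s': "s \<in> polys d - P" "z = s *s f" using z(2) by blast
    obtain x r where "z = x + r *s u" and x: "x \<in> M" and r: "r \<in> polys d"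
      using z(1) by blast
    with s' have s: "s \<in> polys d - P" "s *s f = x + r *s u" by simp_all
    \<comment> \<open>Otherwise \<open>r *s u\<close> would already be in \<open>M\<close>, and so would \<open>s *s f\<close>.\<close>
    have "r \<notin> P"
    proof
      assume "r \<in> P"
      then have "s *s f \<in> M" using s(2) PM[OF _ u] x M'(3) by simp
      then show False using s(1) in_P by blast
    qed
    moreover have "r *s u - s *s f \<in> M"
      using submodule_of_diff[OF M(1) M'(2) x] s(2) by simp
    ultimately show ?thesis using r s(1) by blast
  qed
  have axis: "(axis i 1 :: 'k mpoly ^ 'n) \<in> poly_vecs d" for i
    using zero one by (auto simp: poly_vecs_def axis_def)
  have "\<forall>i::'n. \<exists>r s. r \<in> polys d - P \<and> s \<in> polys d \<and> r *s axis i 1 - s *s f \<in> M"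
    using ex[OF axis] by blast
  then obtain r s where r: "\<And>i::'n. r i \<in> polys d - P" and s: "\<And>i. s i \<in> polys d"
    and rs: "\<And>i. r i *s axis i 1 - s i *s f \<in> M"
    by metis
  define R where "R = prod r UNIV"
  define w :: "'k mpoly ^ 'n" where "w = (\<chi> i. prod r (UNIV - {i}) * s i)"
  have w: "w \<in> poly_vecs d"
    using r s by (auto simp: poly_vecs_def w_def intro!: mult prod)
  have R: "R \<in> polys d" "R \<notin> P"
    using r prod[of UNIV r] prod_notin[of UNIV r] by (simp_all add: R_def)
  have R_axis: "R *s axis i 1 - (w $ i) *s f \<in> M" for i
  proof -
    have "R = prod r (UNIV - {i}) * r i"
      by (simp add: R_def prod.remove[of UNIV i] mult.commute)
    then have "R *s axis i 1 - (w $ i) *s f = prod r (UNIV - {i}) *s (r i *s axis i 1 - s i *s f)"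
      by (simp add: w_def vector_ssub_ldistrib vector_smult_assoc)
    then show ?thesis
      using M'(4)[OF prod rs] r by (metis DiffD1)
  qed
  have key: "R *s u - dot u w *s f \<in> M" if u: "u \<in> poly_vecs d" for u
  proof -
    have "R *s u - dot u w *s f = (\<Sum>i\<in>UNIV. u $ i *s (R *s axis i 1 - (w $ i) *s f))"
      using arg_cong[OF vec_eq_sum_axis[of u], of "\<lambda>v. R *s v"]
      by (simp add: vec_eq_iff sum_component right_diff_distrib sum_subtractf
          sum_distrib_right sum_distrib_left mult_ac)
    also have "\<dots> \<in> M"
      using u by (intro submodule_of_sum[OF M(1)] M'(4) R_axis) (simp add: poly_vecs_def)
    finally show ?thesis .
  qed
  have dot: "dot u w \<in> polys d" if "u \<in> poly_vecs d" for u
    using that w by (auto simp: poly_vecs_def intro!: sum mult)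
  have "dot u w \<in> P" if "u \<in> N" for u
  proof -
    have u: "u \<in> M" "u \<in> poly_vecs d" using that M(2) M'(1) by auto
    have "dot u w *s f \<in> M"
      using submodule_of_diff[OF M(1) M'(4)[OF R(1) u(1)] key[OF u(2)]] by simp
    then show ?thesis using in_P dot u(2) by blast
  qed
  moreover have "dot f w \<notin> P"
  proof
    assume "dot f w \<in> P"
    moreover have "R - dot f w \<in> P"
      using key[OF f(1)] in_P[OF diff[OF R(1) dot[OF f(1)]]] by (simp add: vector_sub_rdistrib)
    ultimately show False using add_mem[of "R - dot f w" "dot f w"] R(2) by simp
  qed
  ultimately show ?thesis using w by blast
qed

section \<open>Semiprime submodules\<close>

text \<open>
  The \<open>i\<close>-th coordinate of \<open>x *s f\<close>, times \<open>x *s f\<close>, is \<open>f $ i\<close> times \<open>(x * x) *s f\<close>. Hence the colon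
  ideal of \<open>f\<close> into a semiprime submodule is radical.
\<close>

lemma semiprime_colon_radical:
  assumes N: "semiprime d N" and f: "f \<in> poly_vecs d" "x \<in> polys d" "(x * x) *s f \<in> N"
  shows "x *s f \<in> N"
proof -
  have "((x *s f) $ i) *s (x *s f) = (f $ i) *s ((x * x) *s f)" for i
    by (simp add: vector_smult_assoc mult_ac)
  moreover have "(f $ i) *s ((x * x) *s f) \<in> N" for i
    using N f unfolding semiprime_def submodule_of_def poly_vecs_def by blast
  moreover have "x *s f \<in> poly_vecs d"
    using f polys_mult by (auto simp: poly_vecs_def)
  ultimately show ?thesis
    using N unfolding semiprime_def by metis
qed

text \<open>
  The heart of the proof. Let \<open>P\<close> be a minimal prime over the colon ideal \<open>J\<close> of \<open>f\<close> into \<open>N\<close>.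
  By \<open>ex_separating_functional\<close> it is enough to show that no \<open>s *s f\<close> with \<open>s \<notin> P\<close> can be written as
  \<open>x + q\<close> with \<open>x \<in> N\<close> and all coordinates of \<open>q\<close> in \<open>P\<close>. As \<open>P\<close> is minimal, multiplication by some
  \<open>C \<notin> P\<close> moves the coordinates of \<open>q\<close> into \<open>J\<close>, so suppose that they are there already. Then
  \<open>q $ i *s q = s *s (q $ i *s f) - q $ i *s x\<close> is in \<open>N\<close> for all \<open>i\<close>, and semiprimality yields \<open>q \<in> N\<close>.
  Hence \<open>s *s f \<in> N\<close>, that is \<open>s \<in> J\<close>, which contradicts \<open>s \<notin> P\<close>.
\<close>

lemma semiprime_ex_separating_functional:
  fixes f :: "'k::comm_ring_1 mpoly ^ 'n::finite"
  assumes N: "semiprime d N" and f: "f \<in> poly_vecs d" "f \<notin> N"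
  shows "\<exists>P. prime_ideal (polys d) P \<and>
    (\<exists>w\<in>poly_vecs d. (\<forall>u\<in>N. dot u w \<in> P) \<and> dot f w \<notin> P)"
proof -
  interpret A: subring "polys d" by (rule subring_polys)
  have sub: "submodule_of d N" using N by (simp add: semiprime_def)
  then have N': "N \<subseteq> poly_vecs d" "0 \<in> N" "\<And>x y. x \<in> N \<Longrightarrow> y \<in> N \<Longrightarrow> x + y \<in> N"
    "\<And>r x. r \<in> polys d \<Longrightarrow> x \<in> N \<Longrightarrow> r *s x \<in> N"
    unfolding submodule_of_def by auto
  have N_sp: "u \<in> N" if "u \<in> poly_vecs d" "\<And>i. (u $ i) *s u \<in> N" for u
    using N that unfolding semiprime_def by blast
  let ?J = "{r \<in> polys d. r *s f \<in> N}"
  obtain P where P: "prime_ideal (polys d) P" "?J \<subseteq> P"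
    and P_min: "\<And>q. q \<in> P \<Longrightarrow> \<exists>c\<in>polys d - P. c * q \<in> ?J"
  proof (rule A.ex_minimal_prime[of ?J])
    show "x \<in> ?J" if "x \<in> polys d" "x * x \<in> ?J" for x
      using that semiprime_colon_radical[OF N f(1)] by blast
    show "x + y \<in> ?J" if "x \<in> ?J" "y \<in> ?J" for x y
      using that N'(3)[of "x *s f" "y *s f"] A.add[of x y] by (simp add: vector_sadd_rdistrib)
    show "a * x \<in> ?J" if "a \<in> polys d" "x \<in> ?J" for a x
      using that N'(4)[of a "x *s f"] A.mult[of a x] by (simp add: vector_smult_assoc)
  qed (use f N' A.zero in auto)
  interpret prime_ideal "polys d" P by (rule P)
  let ?L = "{x + q | x q. x \<in> N \<and> (\<forall>i. q $ i \<in> P)}"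
  have L_I: "x + q \<in> ?L" if "x \<in> N" "\<And>i. q $ i \<in> P" for x q
    using that by blast
  have L: "submodule_of d ?L"
    unfolding submodule_of_def
  proof (intro conjI ballI)
    show "?L \<subseteq> poly_vecs d"
    proof
      fix z assume "z \<in> ?L"
      then obtain x q where z: "z = x + q" "x \<in> N" "\<forall>i. q $ i \<in> P" by blast
      then have "x $ i \<in> polys d" "q $ i \<in> polys d" for i
        using N'(1) subset by (auto simp: poly_vecs_def)
      then show "z \<in> poly_vecs d"
        by (simp add: z(1) poly_vecs_def A.add)
    qed
    show "0 \<in> ?L"
      using N'(2) zero_mem by (intro CollectI exI[of _ 0] conjI) auto
    show "x + y \<in> ?L" if xy: "x \<in> ?L" "y \<in> ?L" for x y
    proof -
      obtain v q v' q' where "x = v + q" "y = v' + q'" and *: "v \<in> N" "v' \<in> N"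
        and q: "\<forall>i. q $ i \<in> P" "\<forall>i. q' $ i \<in> P"
        using xy by blast
      then have eq: "x + y = (v + v') + (q + q')" by simp
      have "(q + q') $ i \<in> P" for i using q add_mem by simp
      from L_I[OF N'(3)[OF *] this] show ?thesis by (simp only: eq)
    qed
    show "s *s x \<in> ?L" if s: "s \<in> polys d" and x: "x \<in> ?L" for s x
    proof -
      obtain v q where "x = v + q" and *: "v \<in> N" and q: "\<forall>i. q $ i \<in> P"
        using x by blast
      then have eq: "s *s x = s *s v + s *s q" by (simp add: vector_add_ldistrib)
      have "(s *s q) $ i \<in> P" for i using q mult_mem s by simp
      from L_I[OF N'(4)[OF s *] this] show ?thesis by (simp only: eq)
    qed
  qed
  have miss: "s *s f \<notin> ?L" if s: "s \<in> polys d - P" for s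
  proof
    assume "s *s f \<in> ?L"
    then have "\<exists>x q. s *s f = x + q \<and> x \<in> N \<and> (\<forall>i. q $ i \<in> P)"
      by (simp only: mem_Collect_eq)
    then obtain x q where xq: "s *s f = x + q" "x \<in> N" and qP: "\<And>i. q $ i \<in> P" by blast
    have "\<exists>c. \<forall>i. c i \<in> polys d - P \<and> c i * q $ i \<in> ?J"
      using P_min[OF qP] unfolding Bex_def by (intro choice allI)
    then obtain c where c: "\<And>i. c i \<in> polys d - P" "\<And>i. c i * q $ i \<in> ?J" by blast
    define C where "C = prod c UNIV"
    have C: "C \<in> polys d" "C \<notin> P"
      using c(1) A.prod[of UNIV c] prod_notin[of UNIV c] by (simp_all add: C_def)
    let ?q = "C *s q"
    have qJ: "(?q $ i) *s f \<in> N" for i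
    proof -
      have "C = prod c (UNIV - {i}) * c i"
        by (simp add: C_def prod.remove[of UNIV i] mult.commute)
      then have "(?q $ i) *s f = prod c (UNIV - {i}) *s ((c i * q $ i) *s f)"
        by (simp add: vector_smult_assoc mult_ac)
      moreover have "prod c (UNIV - {i}) \<in> polys d"
        using c(1) by (intro A.prod) auto
      ultimately show ?thesis using c(2)[of i] N'(4) by simp
    qed
    have q_poly: "?q \<in> poly_vecs d"
      using qP C subset by (auto simp: poly_vecs_def intro!: A.mult)
    have "?q \<in> N"
    proof (rule N_sp[OF q_poly])
      fix i
      have q_i: "?q $ i \<in> polys d" using q_poly by (simp add: poly_vecs_def)
      have "?q = (C * s) *s f - C *s x"
        using arg_cong[OF xq(1), of "\<lambda>v. C *s v"]
        by (simp add: vector_add_ldistrib vector_smult_assoc)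
      from arg_cong[OF this, of "\<lambda>v. (?q $ i) *s v"]
      have "(?q $ i) *s ?q = (C * s) *s ((?q $ i) *s f) - (?q $ i) *s (C *s x)"
        by (simp add: vector_ssub_ldistrib vector_smult_assoc mult_ac)
      also have "\<dots> \<in> N"
        using s
        by (intro submodule_of_diff[OF sub] N'(4)[OF A.mult[OF C(1)] qJ]
            N'(4)[OF q_i N'(4)[OF C(1) xq(2)]]) simp
      finally show "(?q $ i) *s ?q \<in> N" .
    qed
    then have "(C * s) *s f \<in> N"
      using N'(3)[OF N'(4)[OF C(1) xq(2)]] arg_cong[OF xq(1), of "\<lambda>v. C *s v"]
      by (simp add: vector_add_ldistrib vector_smult_assoc)
    then have "C * s \<in> P" using P(2) A.mult[OF C(1), of s] s by auto
    then show False using prime[OF C(1), of s] C(2) s by auto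
  qed
  have PL: "u \<in> ?L" if "\<And>i. u $ i \<in> P" for u
    using L_I[OF N'(2) that] by (simp only: add_0)
  have "\<exists>w\<in>poly_vecs d. (\<forall>u\<in>?L. dot u w \<in> P) \<and> dot f w \<notin> P"
    using P(1) L PL f(1) miss by (rule ex_separating_functional)
  moreover have "x \<in> ?L" if "x \<in> N" for x
    using L_I[OF that, of 0] zero_mem by (simp only: zero_index add_0_right)
  ultimately have "\<exists>w\<in>poly_vecs d. (\<forall>u\<in>N. dot u w \<in> P) \<and> dot f w \<notin> P"
    by (meson)
  then show ?thesis
    using P(1) by blast
qed

text \<open>
  If the pairing \<open>e\<close> of \<open>u\<close> with \<open>v\<close> at \<open>a\<close> is such that all multiples of \<open>u\<close> by its own coordinates
  pair to zero, then \<open>e * e = 0\<close>, as \<open>e\<close> is a linear combination of the coordinates of \<open>u\<close> at \<open>a\<close>.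
\<close>

lemma semiprime_vanishing:
  fixes Z :: "((nat \<Rightarrow> 'k::idom) \<times> ('k ^ 'n::finite)) set"
  shows "semiprime d {u \<in> poly_vecs d. \<forall>(a, v)\<in>Z. eval_pair u a v = 0}"
proof -
  interpret subring "polys d :: 'k mpoly set" by (rule subring_polys)
  have add': "eval_pair (x + y) a v = eval_pair x a v + eval_pair y a v"
    for x y and a and v :: "'k ^ 'n"
    by (simp add: eval_pair_def eval_poly_add distrib_right sum.distrib)
  have mult': "eval_pair (r *s x) a v = eval_poly a r * eval_pair x a v"
    for x r and a and v :: "'k ^ 'n"
    by (simp add: eval_pair_def eval_poly_mult sum_distrib_left mult_ac)
  have zero': "eval_pair 0 a v = 0" for a and v :: "'k ^ 'n"
    by (simp add: eval_pair_def eval_poly_def)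
  have "eval_pair u a v = 0" if "\<And>i. eval_pair ((u $ i) *s u) a v = 0" for u a and v :: "'k ^ 'n"
  proof -
    have "eval_pair u a v * eval_pair u a v = (\<Sum>i\<in>UNIV. v $ i * eval_pair ((u $ i) *s u) a v)"
      unfolding mult' by (subst (1) eval_pair_def) (simp add: sum_distrib_left mult_ac)
    then show ?thesis using that by simp
  qed
  then show ?thesis
    by (auto simp: semiprime_def submodule_of_def poly_vecs_def zero add mult add' mult' zero'
        split: prod.splits)
qed

section \<open>The Nullstellensatz for semiprime submodules\<close>

theorem theorem2:
  fixes d m :: nat
    and g :: "nat \<Rightarrow> 'k::alg_closed_field mpoly ^ 'n::finite"
    and f :: "'k mpoly ^ 'n"
  assumes "\<And>j. j \<in> {1..m} \<Longrightarrow> g j \<in> poly_vecs d"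
    and "f \<in> poly_vecs d"
  shows "f \<in> semiprime_closure d (g ` {1..m}) \<longleftrightarrow>
    (\<forall>a \<in> affine_space d. \<forall>v :: 'k ^ 'n.
       (\<forall>j \<in> {1..m}. eval_pair (g j) a v = 0) \<longrightarrow> eval_pair f a v = 0)"
proof
  have G: "g ` {1..m} \<subseteq> poly_vecs d" using assms(1) by blast
  note closure = semiprime_closure_least[OF G]
  {
    let ?Z = "{(a, v). \<forall>j\<in>{1..m}. eval_pair (g j) a v = 0}"
    assume "f \<in> semiprime_closure d (g ` {1..m})"
    moreover have "g ` {1..m} \<subseteq> {u \<in> poly_vecs d. \<forall>(a, v)\<in>?Z. eval_pair u a v = 0}"
      using G by auto
    ultimately have "f \<in> {u \<in> poly_vecs d. \<forall>(a, v)\<in>?Z. eval_pair u a v = 0}"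
      using closure(3)[OF semiprime_vanishing] by blast
    then show "\<forall>a \<in> affine_space d. \<forall>v :: 'k ^ 'n.
       (\<forall>j \<in> {1..m}. eval_pair (g j) a v = 0) \<longrightarrow> eval_pair f a v = 0"
      by blast
  }
  assume vanish: "\<forall>a \<in> affine_space d. \<forall>v :: 'k ^ 'n.
       (\<forall>j \<in> {1..m}. eval_pair (g j) a v = 0) \<longrightarrow> eval_pair f a v = 0"
  show "f \<in> semiprime_closure d (g ` {1..m})"
  proof (rule ccontr)
    assume "f \<notin> semiprime_closure d (g ` {1..m})"
    then obtain P w where P: "prime_ideal (polys d) P" and w: "w \<in> poly_vecs d"
      "\<And>u. u \<in> semiprime_closure d (g ` {1..m}) \<Longrightarrow> dot u w \<in> P" "dot f w \<notin> P"
      using semiprime_ex_separating_functional[OF closure(1) assms(2)] by blast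
    interpret prime_ideal "polys d" P by (rule P)
    have "dot f w \<in> polys d"
      using assms(2) w(1) by (auto simp: poly_vecs_def intro!: sum mult)
    then obtain a where a: "a \<in> affine_space d" "\<forall>p\<in>P. eval_poly a p = 0" "eval_poly a (dot f w) \<noteq> 0"
      using prime_ideal_ex_point[OF P _ w(3)] by blast
    \<comment> \<open>The functional \<open>w\<close>, evaluated at \<open>a\<close>, is the vector that violates the vanishing condition.\<close>
    have dot: "eval_poly a (dot u w) = eval_pair u a (\<chi> i. eval_poly a (w $ i))" for u
      by (simp add: eval_pair_def eval_poly_sum eval_poly_mult)
    have "\<forall>j\<in>{1..m}. eval_pair (g j) a (\<chi> i. eval_poly a (w $ i)) = 0"
      using closure(2) w(2) a(2) unfolding dot[symmetric] by blast
    then show False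
      using vanish a(1,3) unfolding dot by blast
  qed
qed

end
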